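(* Let $d$ and $m$ be integers with $1\leq m<d$, and let $p$ be a real number with $$1\leq p\leq \frac{2\log\frac{2m+1}{2m}}{\log\frac{m+1}{m}}.$$ Then for every real $(d+m)\times(d+m)$ matrix $A$ of rank $d$ with all diagonal entries equal to $1$, $$E_p(A)=\sum_{i\neq j}|A_{i,j}|^{p}\geq 2m.$$
   Context: For a real $N\times N$ matrix $A=(A_{i,j})$ the $p$-frame energy is $E_p(A)=\sum_{i\neq j}|A_{i,j}|^p$, where the sum is over all ordered pairs $(i,j)$ with $1\leq i,j\leq N$ and $i\neq j$ (so each off-diagonal entry contributes once). Here $N=d+m$. *)

theory Defs
  imports "HOL-Analysis.Analysis"
begin

text \<open>For \<open>p > 0\<close> a zero entry contributes \<open>0\<close>, because \<open>0 powr p = 0\<close>.\<close>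

definition frame_energy :: "real \<Rightarrow> real^'n^'n \<Rightarrow> real" where
  "frame_energy p A = (\<Sum>(i, j) \<in> {(i, j). i \<noteq> j}. \<bar>A $ i $ j\<bar> powr p)"

end

theory Submission
  imports Defs
begin

text \<open>
  The energy is bounded below through the orthogonal projection \<open>P\<close> onto the null space of \<open>A\<close>. Its
  diagonal entries \<open>t i\<close> sum to the dimension \<open>m\<close> of the null space. Since column \<open>i\<close> of \<open>P\<close> is
  annihilated by \<open>A\<close> and has squared norm \<open>t i\<close>, Cauchy-Schwarz applied to row \<open>i\<close> of \<open>A\<close> shows that
  the off-diagonal entries of this row have square sum at least \<open>t i / (1 - t i)\<close>; because \<open>p \<le> 2\<close>,
  the row contributes at least \<open>(t i / (1 - t i)) powr (p / 2)\<close> to the energy (\<open>row_energy_ge\<close>).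

  This leaves an inequality about numbers \<open>t i\<close> in \<open>{0..<1}\<close> with sum \<open>m\<close>: the sum of the powers of
  their odds is at least \<open>2m\<close> (\<open>sum_odds_powr_ge\<close>). The value \<open>2m\<close> is attained by \<open>2m\<close> numbers
  equal to \<open>1/2\<close>. The natural competitor consists of \<open>2m + 1\<close> numbers equal to \<open>m / (2m + 1)\<close>, and the
  bound on \<open>p\<close> says precisely that it is not better. Here it matters that \<open>m\<close> is an integer: the bound
  \<open>2 t \<le> (t / (1 - t)) powr (p / 2)\<close> holds for \<open>t \<le> m / (2m + 1)\<close> and for \<open>t \<ge> 1/2\<close> but can fail
  in between, and a count of the numbers \<open>t i \<ge> 1/4\<close> reduces everything to these two ranges, or to
  \<open>2m\<close> equal numbers together with one small one. This family interpolates between the two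
  extremal configurations, and it is treated by the sign changes of a derivative
  (\<open>odds_powr_two_level\<close>).
\<close>

section \<open>Powers of the odds of a number in the unit interval\<close>

definition odds_powr :: "real \<Rightarrow> real \<Rightarrow> real" where
  "odds_powr b t = (t / (1 - t)) powr b"

lemma odds_powr_nonneg [simp]: "0 \<le> odds_powr b t"
  by (simp add: odds_powr_def)

lemma odds_powr_0 [simp]: "odds_powr b 0 = 0"
  by (simp add: odds_powr_def)

lemma odds_powr_half [simp]: "odds_powr b (1/2) = 1"
  by (simp add: odds_powr_def)

lemma has_derivative_odds_powr:
  assumes "0 < t" "t < 1"
  shows "(odds_powr b has_real_derivative odds_powr b t * (b / (t * (1 - t)))) (at t)"
proof -
  have d: "((\<lambda>t. t / (1 - t)) has_real_derivative 1 / (1 - t)^2) (at t)"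
    using assms by (auto intro!: derivative_eq_intros simp: power2_eq_square field_simps)
  have eq: "0 * ln (t / (1 - t)) + 1 / (1 - t)^2 * b / (t / (1 - t)) = b / (t * (1 - t))"
    using assms by (simp add: power2_eq_square)
  show ?thesis
    using DERIV_powr[OF d _ DERIV_const[of b]] assms
    unfolding eq odds_powr_def[abs_def] by simp
qed

lemma continuous_on_odds_powr:
  assumes "0 < b" "A \<subseteq> {0..<1}"
  shows "continuous_on A (odds_powr b)"
  unfolding odds_powr_def[abs_def]
  using assms by (intro continuous_on_powr' continuous_intros) fastforce+

text \<open>The second derivative has the sign of \<open>b - 1 + 2 * t\<close>, so the inflection point \<open>(1 - b) / 2\<close> is
  at most \<open>1/4\<close>. In the sum inequality below, the threshold must be no larger than this, so that
  small numbers replaced by copies of it count with total weight at least four times their sum.\<close>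

lemma convex_on_odds_powr:
  assumes "1/2 \<le> b"
  shows "convex_on {1/4..<1} (odds_powr b)"
proof (rule f''_ge0_imp_convex)
  fix t :: real assume t: "t \<in> {1/4..<1}"
  then have t': "0 < t" "t < 1" by auto
  show "DERIV (odds_powr b) t :> odds_powr b t * (b / (t * (1 - t)))"
    by (rule has_derivative_odds_powr[OF t'])
  have d: "((\<lambda>t. b / (t * (1 - t))) has_real_derivative b * (2 * t - 1) / (t * (1 - t))^2) (at t)"
    using t' by (auto intro!: derivative_eq_intros simp: power2_eq_square field_simps)
  have "((\<lambda>t. odds_powr b t * (b / (t * (1 - t)))) has_real_derivative
     odds_powr b t * (b / (t * (1 - t))) * (b / (t * (1 - t)))
     + b * (2 * t - 1) / (t * (1 - t))^2 * odds_powr b t) (at t)"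
    by (rule DERIV_mult[OF has_derivative_odds_powr[OF t'] d])
  moreover have "odds_powr b t * (b / (t * (1 - t))) * (b / (t * (1 - t)))
     + b * (2 * t - 1) / (t * (1 - t))^2 * odds_powr b t
     = odds_powr b t * b * (b - 1 + 2 * t) / (t * (1 - t))^2"
    using t' by (simp add: power2_eq_square add_divide_distrib diff_divide_distrib algebra_simps)
  ultimately show "DERIV (\<lambda>t. odds_powr b t * (b / (t * (1 - t)))) t :>
      odds_powr b t * b * (b - 1 + 2 * t) / (t * (1 - t))^2" by simp
  show "0 \<le> odds_powr b t * b * (b - 1 + 2 * t) / (t * (1 - t))^2"
    using t assms by auto
qed auto

text \<open>The function \<open>odds_powr b t / t\<close> decreases up to its minimum at \<open>t = 1 - b\<close>. Instead of
  differentiating, one bounds the quotient of two of its values by weighted AM-GM; the arithmetic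
  mean is affine in \<open>x\<close>, equals \<open>1\<close> at \<open>x = y\<close> and has nonnegative slope when \<open>y \<le> 1 - b\<close>.\<close>

lemma odds_powr_ratio_mono:
  assumes "0 \<le> x" "x \<le> y" "y \<le> 1 - b" "0 < b" 
  shows "x * odds_powr b y \<le> y * odds_powr b x"
proof (cases "x = 0")
  case False
  then have xy: "0 < x" "0 < y" "y < 1" "x < 1" using assms by auto
  have "(x / y) powr (1 - b) * ((1 - x) / (1 - y)) powr b
      \<le> (1 - b) * (x / y) + b * ((1 - x) / (1 - y))"
    using assms xy by (intro Youngs_inequality_0) auto
  also have "\<dots> = 1 - (y - x) * ((1 - b) - y) / (y * (1 - y))"
    using xy by (simp add: field_simps) 
  also have "\<dots> \<le> 1" using assms xy by simp
  finally have *: "(x / y) powr (1 - b) * ((1 - x) / (1 - y)) powr b \<le> 1" .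
  have "x * odds_powr b y = y * odds_powr b x * ((x / y) powr (1 - b) * ((1 - x) / (1 - y)) powr b)"
    using xy by (simp add: odds_powr_def powr_divide powr_diff field_simps)
  also have "\<dots> \<le> y * odds_powr b x * 1"
    using * xy by (intro mult_left_mono) auto
  finally show ?thesis by simp
qed (use assms in auto)

lemma odds_powr_ge_of_half_le:
  assumes "1/2 \<le> b" "1/2 \<le> t" "t < 1"
  shows "2 * t \<le> odds_powr b t"
proof -
  have "(2 * t)^2 \<le> t / (1 - t)"
  proof -
    have "0 \<le> t * (1 - 2 * t)^2" using assms by simp
    then have "(2 * t)^2 * (1 - t) \<le> t" by (simp add: power2_eq_square algebra_simps)
    then show ?thesis using assms by (simp add: pos_le_divide_eq)
  qed
  then have "2 * t \<le> sqrt (t / (1 - t))" by (rule real_le_rsqrt)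
  also have "\<dots> = (t / (1 - t)) powr (1/2)" using assms by (simp add: powr_half_sqrt)
  also have "\<dots> \<le> odds_powr b t"
    unfolding odds_powr_def using assms by (intro powr_mono) auto
  finally show ?thesis .
qed

text \<open>Concavity of the logarithm at \<open>2m / (2m + 1)\<close>, a convex combination of \<open>m / (m + 1)\<close> and \<open>1\<close>.
  The conclusion says that \<open>m / (2m + 1)\<close> lies in the range \<open>t \<le> 1 - b\<close> where
  \<open>odds_powr b t / t\<close> decreases.\<close>

lemma exponent_le:
  fixes m b :: real
  assumes "1 \<le> m" "b \<le> ln ((2 * m + 1) / (2 * m)) / ln ((m + 1) / m)"
  shows "b \<le> (m + 1) / (2 * m + 1)"
proof -
  have pos: "0 < ln ((m + 1) / m)" using assms by simp
  have conc: "u * ln x + v * ln y \<le> ln (u * x + v * y)"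
    if "0 < x" "0 < y" "0 \<le> u" "0 \<le> v" "u + v = 1" for u v x y :: real
    using ln_concave that unfolding concave_on_iff by auto
  have "(m + 1) / (2 * m + 1) * ln (m / (m + 1)) + m / (2 * m + 1) * ln 1
     \<le> ln ((m + 1) / (2 * m + 1) * (m / (m + 1)) + m / (2 * m + 1) * 1)"
  proof (rule conc)
    show "(m + 1) / (2 * m + 1) + m / (2 * m + 1) = 1"
      using assms by (simp flip: add_divide_distrib)
  qed (use assms in auto)
  also have "(m + 1) / (2 * m + 1) * (m / (m + 1)) + m / (2 * m + 1) * 1 = (2 * m) / (2 * m + 1)"
    using assms by (simp flip: add_divide_distrib)
  finally have *: "(m + 1) / (2 * m + 1) * ln (m / (m + 1)) \<le> ln (2 * m / (2 * m + 1))"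
    by simp
  have "ln ((2 * m + 1) / (2 * m)) \<le> (m + 1) / (2 * m + 1) * ln ((m + 1) / m)"
  proof -
    have "ln (m / (m + 1)) = - ln ((m + 1) / m)"
      "ln (2 * m / (2 * m + 1)) = - ln ((2 * m + 1) / (2 * m))"
      using assms by (simp_all add: ln_div)
    then show ?thesis
      using * by simp
  qed
  then have "ln ((2 * m + 1) / (2 * m)) / ln ((m + 1) / m) \<le> (m + 1) / (2 * m + 1)"
    using pos by (simp add: pos_divide_le_eq)
  then show ?thesis using assms by simp
qed

text \<open>The bound on the exponent, rewritten: it says exactly that \<open>2m + 1\<close> equal numbers
  \<open>m / (2m + 1)\<close> do not beat \<open>2m\<close> numbers equal to \<open>1/2\<close>.\<close>

lemma odds_powr_threshold:
  fixes m b :: real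
  assumes "1 \<le> m" "b \<le> ln ((2 * m + 1) / (2 * m)) / ln ((m + 1) / m)"
  shows "2 * (m / (2 * m + 1)) \<le> odds_powr b (m / (2 * m + 1))"
proof -
  have pos: "0 < ln ((m + 1) / m)" using assms by simp
  have e: "m / (2 * m + 1) / (1 - m / (2 * m + 1)) = m / (m + 1)"
  proof -
    have "1 - m / (2 * m + 1) = (m + 1) / (2 * m + 1)" using assms by (simp add: field_simps)
    then show ?thesis using assms by simp
  qed
  have "b * ln ((m + 1) / m) \<le> ln ((2 * m + 1) / (2 * m))"
    using assms pos by (simp add: pos_le_divide_eq)
  then have "ln (2 * m / (2 * m + 1)) \<le> b * ln (m / (m + 1))"
    using assms by (simp add: ln_div algebra_simps)
  then have "exp (ln (2 * m / (2 * m + 1))) \<le> exp (b * ln (m / (m + 1)))" by simp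
  then show ?thesis
    unfolding odds_powr_def e using assms by (simp add: powr_def)
qed

lemma odds_powr_ge_of_le_threshold:
  assumes "1 \<le> m" "0 < b" "b \<le> ln ((2 * m + 1) / (2 * m)) / ln ((m + 1) / m)"
    and "0 \<le> t" "t \<le> m / (2 * m + 1)"
  shows "2 * t \<le> odds_powr b t"
proof -
  let ?u = "m / (2 * m + 1)"
  have u: "0 < ?u" using assms by simp
  have "?u \<le> 1 - b"
  proof -
    have "1 - (m + 1) / (2 * m + 1) = ?u" using assms by (simp add: field_simps)
    then show ?thesis using exponent_le[OF assms(1,3)] by linarith
  qed
  then have "t * odds_powr b ?u \<le> ?u * odds_powr b t"
    using assms by (intro odds_powr_ratio_mono) auto
  moreover have "t * (2 * ?u) \<le> t * odds_powr b ?u"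
    using odds_powr_threshold[OF assms(1,3)] assms(4) by (rule mult_left_mono)
  ultimately have "?u * (2 * t) \<le> ?u * odds_powr b t" by (simp only: mult.commute mult.left_commute)
  then show ?thesis using u by (rule mult_left_le_imp_le)
qed

section \<open>One small value next to equal large ones\<close>

text \<open>In this form the logarithm of the derivative is elementary, so two values of the derivative
  can be compared through a function with a rational derivative.\<close>

lemma odds_powr_derivative_eq_exp:
  assumes "0 < t" "t < 1"
  shows "odds_powr b t * (b / (t * (1 - t))) = b * exp ((b - 1) * ln t - (b + 1) * ln (1 - t))"
proof -
  have "odds_powr b t = exp (b * ln t - b * ln (1 - t))"
    using assms by (simp add: odds_powr_def powr_def ln_div algebra_simps)
  moreover have "1 / (t * (1 - t)) = exp (- ln t - ln (1 - t))"
    using assms by (simp add: exp_diff exp_minus divide_inverse)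
  ultimately have "odds_powr b t * (1 / (t * (1 - t))) = exp (b * ln t - b * ln (1 - t) + (- ln t - ln (1 - t)))"
    by (simp only: exp_add)
  also have "b * ln t - b * ln (1 - t) + (- ln t - ln (1 - t)) = (b - 1) * ln t - (b + 1) * ln (1 - t)"
    by (simp add: algebra_simps)
  finally show ?thesis by (metis mult.left_commute mult.right_neutral times_divide_eq_right)
qed

text \<open>Monotonicity of \<open>x (m - x) / ((1 - x) (m + x))\<close>, cleared of denominators: the difference of the
  two sides factors.\<close>

lemma rational_quotient_mono:
  fixes m x y :: real
  assumes "1 \<le> m" "0 < x" "x < y" "y < 1"
  shows "x * (m - x) * ((1 - y) * (m + y)) \<le> y * (m - y) * ((1 - x) * (m + x))"
proof -
  have "0 \<le> (y - x) * ((m - x) * (m - y) + 2 * x * y * (m - 1))"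
    using assms by auto
  also have "\<dots> = y * (m - y) * ((1 - x) * (m + x)) - x * (m - x) * ((1 - y) * (m + y))"
    by algebra
  finally show ?thesis by simp
qed

lemma mean_value_continuous:
  fixes f :: "real \<Rightarrow> real"
  assumes "x < y" "continuous_on {x..y} f"
    and "\<And>z. x < z \<Longrightarrow> z < y \<Longrightarrow> (f has_real_derivative f' z) (at z)"
  obtains z where "x < z" "z < y" "f y - f x = (y - x) * f' z"
  by (rule mvt[OF assms(1,2) assms(3)[unfolded has_field_derivative_def]])
     (auto simp: mult.commute intro: that)

text \<open>The delicate configuration: \<open>2m\<close> equal numbers and one smaller number \<open>r\<close>, with total \<open>m\<close>. At both
  ends, \<open>r = 0\<close> and \<open>r = m / (2m + 1)\<close>, the inequality holds, the latter being the threshold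
  condition on \<open>b\<close>; for the extremal \<open>b\<close> both are equalities, so no linear bound on the single
  terms can work. The left-hand side \<open>G\<close> is shown to have no interior minimum below its end values:
  \<open>G'\<close> has the sign of \<open>Q\<close>, the difference of the logarithms of the derivative at the two levels.
  A value of \<open>G\<close> below both end values would make \<open>Q\<close> negative, then positive, and finally \<open>0\<close>
  where the two levels meet. Hence \<open>Q'\<close>, which has the sign of the quadratic \<open>K\<close>, would be positive and
  later negative, whereas \<open>K\<close> stays positive once it is positive.\<close>

lemma odds_powr_two_level:
  fixes m b r :: real
  assumes m: "1 \<le> m" and b: "1/2 \<le> b" "b \<le> ln ((2 * m + 1) / (2 * m)) / ln ((m + 1) / m)"
    and r: "0 \<le> r" "r \<le> m / (2 * m + 1)"
  shows "2 * m \<le> 2 * m * odds_powr b (1/2 - r / (2 * m)) + odds_powr b r"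
proof (rule ccontr)
  define u where "u = m / (2 * m + 1)"
  define s where "s x = 1/2 - x / (2 * m)" for x
  define G where "G x = 2 * m * odds_powr b (s x) + odds_powr b x" for x
  define L where "L t = (b - 1) * ln t - (b + 1) * ln (1 - t)" for t
  define Q where "Q x = L x - L (s x)" for x
  define K where "K x = (1 + b) * (m + 1) * (x * (m - x)) - (1 - b) * m * ((1 - x) * (m + x))" for x
  assume "\<not> ?thesis"
  then have less: "G r < 2 * m" by (simp add: G_def s_def)
  have u: "0 < u" "u < 1/2" using m by (auto simp: u_def field_simps)
  have bpos: "0 < b" using b by simp
  have "b < 1" using exponent_le[OF m b(2)] m by (smt (verit) divide_less_eq_1)
  have um: "u * (2 * m + 1) = m" using m by (simp add: u_def)
  then have su: "s u = u" using m by (simp add: s_def field_simps)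
  have s01: "0 < s x \<and> s x < 1" if "0 \<le> x" "x < 1" for x
    using that m by (auto simp: s_def field_simps)
  have G0: "G 0 = 2 * m" by (simp add: G_def s_def)
  have "G u = (2 * m + 1) * odds_powr b u" by (simp add: G_def su algebra_simps)
  also have "\<dots> \<ge> (2 * m + 1) * (2 * u)"
    using odds_powr_threshold[OF m b(2)] m by (intro mult_left_mono) (auto simp: u_def)
  also have "(2 * m + 1) * (2 * u) = 2 * m" using um by (simp add: algebra_simps)
  finally have Gu: "2 * m \<le> G u" by simp
  have r0: "0 < r" and ru: "r < u"
    using less G0 Gu r unfolding u_def[symmetric] by (metis less_le not_less)+
  have dG: "(G has_real_derivative b * exp (L x) - b * exp (L (s x))) (at x)"
    if "0 < x" "x < 1" for x
  proof -
    have ds: "(s has_real_derivative - (1 / (2 * m))) (at x)"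
      unfolding s_def[abs_def] using m by (auto intro!: derivative_eq_intros)
    have d: "(odds_powr b has_real_derivative b * exp (L t)) (at t)" if "0 < t" "t < 1" for t
      using has_derivative_odds_powr[OF that] odds_powr_derivative_eq_exp[OF that] by (simp add: L_def)
    have "(G has_real_derivative 2 * m * (b * exp (L (s x)) * - (1 / (2 * m))) + b * exp (L x)) (at x)"
      unfolding G_def[abs_def] using that s01[of x]
      by (intro DERIV_add DERIV_cmult DERIV_chain2[OF d ds] d) auto
    then show ?thesis using m by (simp add: algebra_simps)
  qed
  have cG: "continuous_on {x..y} G" if "0 \<le> x" "y \<le> u" for x y
    unfolding G_def[abs_def]
  proof (intro continuous_intros)
    show "continuous_on {x..y} (odds_powr b)"
      using that u by (intro continuous_on_odds_powr bpos) auto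
    have "continuous_on {x..y} (odds_powr b \<circ> s)"
    proof (rule continuous_on_compose)
      show "continuous_on {x..y} s" unfolding s_def[abs_def] using m by (intro continuous_intros) auto
      show "continuous_on (s ` {x..y}) (odds_powr b)"
        using that u s01 by (intro continuous_on_odds_powr bpos) (force simp: less_imp_le)
    qed
    then show "continuous_on {x..y} (\<lambda>x. odds_powr b (s x))" by (simp add: o_def)
  qed
  have dQ: "(Q has_real_derivative K x / (x * (m - x) * ((1 - x) * (m + x)))) (at x)"
    if "0 < x" "x < 1" for x
  proof -
    have ds: "(s has_real_derivative - (1 / (2 * m))) (at x)"
      unfolding s_def[abs_def] using m by (auto intro!: derivative_eq_intros)
    have d: "(L has_real_derivative (b - 1) / t + (b + 1) / (1 - t)) (at t)" if "0 < t" "t < 1" for t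
      unfolding L_def[abs_def] using that
      by (auto intro!: derivative_eq_intros)
    have "(Q has_real_derivative (b - 1) / x + (b + 1) / (1 - x)
        - ((b - 1) / s x + (b + 1) / (1 - s x)) * - (1 / (2 * m))) (at x)"
      unfolding Q_def[abs_def] using that s01[of x]
      by (intro DERIV_diff DERIV_chain2[OF d ds] d) auto
    moreover have "(b - 1) / x + (b + 1) / (1 - x)
        - ((b - 1) / s x + (b + 1) / (1 - s x)) * - (1 / (2 * m))
        = K x / (x * (m - x) * ((1 - x) * (m + x)))" (is "?l = _")
    proof -
      have sx: "s x = (m - x) / (2 * m)" "1 - s x = (m + x) / (2 * m)"
        using m by (auto simp: s_def field_simps)
      have nz: "x \<noteq> 0" "1 - x \<noteq> 0" "m - x \<noteq> 0" "m + x \<noteq> 0" using that m by auto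
      have "?l = (b - 1) * (1 / x + 1 / (m - x)) + (b + 1) * (1 / (1 - x) + 1 / (m + x))"
        unfolding sx using m nz by (simp add: algebra_simps add_divide_distrib diff_divide_distrib)
      also have "1 / x + 1 / (m - x) = m / (x * (m - x))"
        using nz by (simp add: field_simps)
      also have "1 / (1 - x) + 1 / (m + x) = (m + 1) / ((1 - x) * (m + x))"
        using nz by (simp add: divide_simps)
      also have "(b - 1) * (m / (x * (m - x))) + (b + 1) * ((m + 1) / ((1 - x) * (m + x)))
          = K x / (x * (m - x) * ((1 - x) * (m + x)))"
      proof -
        have gen: "(b - 1) * (m / P) + (b + 1) * ((m + 1) / R)
           = ((1 + b) * (m + 1) * P - (1 - b) * m * R) / (P * R)" if "P \<noteq> 0" "R \<noteq> 0" for P R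
          using that by (simp add: field_simps)
        show ?thesis unfolding K_def by (rule gen) (use nz in auto)
      qed
      finally show ?thesis .
    qed
    ultimately show ?thesis by simp
  qed
  have cQ: "continuous_on {x..y} Q" if "0 < x" "y \<le> u" for x y
    by (rule DERIV_continuous_on[where D="\<lambda>x. K x / (x * (m - x) * ((1 - x) * (m + x)))"])
       (rule has_field_derivative_at_within, rule dQ, use that u in auto)
  have neg: "Q x < 0" if "b * exp (L x) - b * exp (L (s x)) < 0" for x
    using that bpos by (simp add: Q_def)
  have pos: "0 < Q x" if "0 < b * exp (L x) - b * exp (L (s x))" for x
    using that bpos by (simp add: Q_def)
  obtain z1 where z1: "0 < z1" "z1 < r"
    "G r - G 0 = (r - 0) * (b * exp (L z1) - b * exp (L (s z1)))"
    by (rule mean_value_continuous[OF r0 cG dG]) (use ru u in auto)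
  have "Q z1 < 0"
  proof (rule neg)
    have "(r - 0) * (b * exp (L z1) - b * exp (L (s z1))) < 0" using z1 less G0 by linarith
    then show "b * exp (L z1) - b * exp (L (s z1)) < 0" using r0 by (simp add: mult_less_0_iff)
  qed
  obtain z2 where z2: "r < z2" "z2 < u"
    "G u - G r = (u - r) * (b * exp (L z2) - b * exp (L (s z2)))"
    by (rule mean_value_continuous[OF ru cG dG]) (use r0 u in auto)
  have "0 < Q z2"
  proof (rule pos)
    have "0 < (u - r) * (b * exp (L z2) - b * exp (L (s z2)))" using z2 less Gu by linarith
    then show "0 < b * exp (L z2) - b * exp (L (s z2))"
      using ru by (simp add: zero_less_mult_iff)
  qed
  have z12: "z1 < z2" using z1 z2 by simp
  obtain w1 where w1: "z1 < w1" "w1 < z2"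
    "Q z2 - Q z1 = (z2 - z1) * (K w1 / (w1 * (m - w1) * ((1 - w1) * (m + w1))))"
    by (rule mean_value_continuous[OF z12 cQ dQ]) (use z1 z2 u in auto)
  obtain w2 where w2: "z2 < w2" "w2 < u"
    "Q u - Q z2 = (u - z2) * (K w2 / (w2 * (m - w2) * ((1 - w2) * (m + w2))))"
    by (rule mean_value_continuous[OF z2(2) cQ dQ]) (use z1 z2 u in auto)
  have w: "0 < w1" "w1 < w2" "w2 < 1" using w1 w2 z1 z2 u by auto
  define f h where "f x = x * (m - x)" and "h x = (1 - x) * (m + x)" for x
  have fh: "0 < f x" "0 < h x" if "0 < x" "x < 1" for x
    using that m by (auto simp: f_def h_def)
  have "0 < (z2 - z1) * (K w1 / (f w1 * h w1))"
    using w1(3) \<open>Q z1 < 0\<close> \<open>0 < Q z2\<close> unfolding f_def h_def by linarith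
  then have "0 < K w1 / (f w1 * h w1)" using z12 by (simp only: zero_less_mult_iff) auto
  moreover have "0 < f w1 * h w1" using fh[of w1] w by simp
  ultimately have "0 < K w1" by (simp only: zero_less_divide_iff) auto
  then have 1: "(1 - b) * m * h w1 < (1 + b) * (m + 1) * f w1" by (simp add: K_def f_def h_def)
  have "Q u = 0" by (simp add: Q_def su)
  then have "(u - z2) * (K w2 / (f w2 * h w2)) < 0"
    using w2(3) \<open>0 < Q z2\<close> unfolding f_def h_def by linarith
  then have "K w2 / (f w2 * h w2) < 0" using z2(2) by (simp only: mult_less_0_iff) auto
  moreover have "0 < f w2 * h w2" using fh[of w2] w by simp
  ultimately have "K w2 < 0" by (simp only: divide_less_0_iff) auto
  then have 2: "(1 + b) * (m + 1) * f w2 < (1 - b) * m * h w2" by (simp add: K_def f_def h_def)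
  have "(1 + b) * (m + 1) * f w2 * h w1 < (1 - b) * m * h w2 * h w1"
    using 2 fh[of w1] w by (intro mult_strict_right_mono) auto
  also have "\<dots> = (1 - b) * m * h w1 * h w2" by simp
  also have "\<dots> < (1 + b) * (m + 1) * f w1 * h w2"
    using 1 fh[of w2] w by (intro mult_strict_right_mono) auto
  also have "\<dots> = (1 + b) * (m + 1) * (f w1 * h w2)" by simp
  also have "\<dots> \<le> (1 + b) * (m + 1) * (f w2 * h w1)"
    using rational_quotient_mono[OF m w(1,2,3)] bpos m
    by (intro mult_left_mono) (auto simp: f_def h_def)
  finally show False by simp
qed

section \<open>The sum inequality\<close>

text \<open>The numbers are split at \<open>1/4\<close>. Those above are replaced by their mean \<open>s\<close> using convexity, and
  \<open>k\<close> is their number; those below have sum \<open>R\<close>. The pointwise bound \<open>2 t \<le> odds_powr b t\<close> fails only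
  for \<open>t\<close> between \<open>m / (2m + 1)\<close> and \<open>1/2\<close>, so the question is what happens when \<open>s\<close> is there.
  This is excluded for \<open>k > 2m\<close>. For \<open>k = 2m\<close> the small numbers may be merged into the single
  number \<open>R\<close>, which leads to the two-level inequality. For \<open>k < 2m\<close> the small numbers are replaced
  by \<open>4R\<close> fictitious copies of \<open>1/4\<close>, after which the total weight \<open>k + 4R\<close> is at least \<open>2m + 1\<close>
  if \<open>s < 1/2\<close>, and the mean of all numbers is small enough for the pointwise bound.\<close>

lemma sum_odds_powr_ge:
  fixes t :: "'i \<Rightarrow> real" and m :: nat and b :: real
  assumes fin: "finite I" and t: "\<And>i. i \<in> I \<Longrightarrow> 0 \<le> t i \<and> t i < 1"
    and sum: "(\<Sum>i\<in>I. t i) = real m" and m1: "1 \<le> m"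
    and b: "1/2 \<le> b" "b \<le> ln ((2 * real m + 1) / (2 * real m)) / ln ((real m + 1) / real m)"
  shows "2 * real m \<le> (\<Sum>i\<in>I. odds_powr b (t i))"
proof -
  define \<phi> where "\<phi> = odds_powr b"
  define u where "u = real m / (2 * real m + 1)"
  define A where "A = {i \<in> I. 1/4 \<le> t i}"
  define k where "k = card A"
  define S where "S = (\<Sum>i\<in>A. t i)"
  define R where "R = (\<Sum>i\<in>I - A. t i)"
  have m: "1 \<le> real m" using m1 by simp
  have bpos: "0 < b" using b by simp
  have um: "u * (2 * real m + 1) = real m" by (simp add: u_def)
  have u: "1/4 \<le> u" "u < 1/2" using m by (auto simp: u_def field_simps)
  have ub: "u \<le> 1 - b"
  proof -
    have "1 - (real m + 1) / (2 * real m + 1) = u" using m by (simp add: u_def field_simps)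
    then show ?thesis using exponent_le[OF m b(2)] by linarith
  qed
  have low: "2 * x \<le> \<phi> x" if "0 \<le> x" "x \<le> u" for x
    using odds_powr_ge_of_le_threshold[OF m bpos b(2)] that by (simp add: \<phi>_def u_def)
  have high: "2 * x \<le> \<phi> x" if "1/2 \<le> x" "x < 1" for x
    using odds_powr_ge_of_half_le[OF b(1) that] by (simp add: \<phi>_def)
  have A: "A \<subseteq> I" "finite A" using fin by (auto simp: A_def)
  have SR: "S + R = real m"
    using sum.subset_diff[OF A(1) fin, of t] sum by (simp add: S_def R_def)
  have split: "(\<Sum>i\<in>I. \<phi> (t i)) = (\<Sum>i\<in>A. \<phi> (t i)) + (\<Sum>i\<in>I - A. \<phi> (t i))"
    using sum.subset_diff[OF A(1) fin, of "\<lambda>i. \<phi> (t i)"] by simp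
  have small: "0 \<le> t i \<and> t i < 1/4" if "i \<in> I - A" for i
    using that t by (auto simp: A_def)
  have R0: "0 \<le> R" unfolding R_def by (rule sum_nonneg) (use small in auto)
  have rest: "2 * R \<le> (\<Sum>i\<in>I - A. \<phi> (t i))"
    unfolding R_def sum_distrib_left
  proof (rule sum_mono)
    fix i assume "i \<in> I - A"
    from small[OF this] show "2 * t i \<le> \<phi> (t i)" using u by (intro low) auto
  qed
  define s where "s = S / real k"
  have jensen: "real k * \<phi> s \<le> (\<Sum>i\<in>A. \<phi> (t i))" and s: "1/4 \<le> s" "s < 1" and ks: "real k * s = S"
    if "0 < k"
  proof -
    have ne: "A \<noteq> {}" using that by (auto simp: k_def)
    have tA: "t i \<in> {1/4..<1}" if "i \<in> A" for i using that t by (auto simp: A_def)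
    have "\<phi> (\<Sum>i\<in>A. (1 / real k) *\<^sub>R t i) \<le> (\<Sum>i\<in>A. (1 / real k) * \<phi> (t i))"
      unfolding \<phi>_def using that tA
      by (intro convex_on_sum[OF A(2) ne convex_on_odds_powr[OF b(1)]]) (auto simp: k_def)
    then have "\<phi> s \<le> (\<Sum>i\<in>A. \<phi> (t i)) / real k"
      by (simp add: s_def S_def sum_divide_distrib)
    then show "real k * \<phi> s \<le> (\<Sum>i\<in>A. \<phi> (t i))" using that by (simp add: field_simps)
    show ks: "real k * s = S" using that by (simp add: s_def)
    have "real k * (1/4) \<le> S" unfolding S_def k_def
      using sum_bounded_below[of A "1/4" t] tA by auto
    then show "1/4 \<le> s" using that by (simp add: s_def field_simps)
    have "S < (\<Sum>i\<in>A. 1)" unfolding S_def using A ne tA by (intro sum_strict_mono) auto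
    then have "S < real k" by (simp add: k_def)
    then show "s < 1" using that by (simp add: s_def)
  qed
  have pointwise: ?thesis if "0 < k" "2 * s \<le> \<phi> s"
  proof -
    have "2 * S = real k * (2 * s)" using ks[OF that(1)] by simp
    also have "\<dots> \<le> real k * \<phi> s" using that by (intro mult_left_mono) auto
    also have "\<dots> \<le> (\<Sum>i\<in>A. \<phi> (t i))" by (rule jensen[OF that(1)])
    finally show ?thesis using rest SR split by (simp add: \<phi>_def)
  qed
  consider "2 * m + 1 \<le> k" | "k = 2 * m" | "k < 2 * m" by linarith
  then show ?thesis
  proof cases
    case 1
    then have k: "0 < k" by simp
    have "s \<le> u"
    proof -
      have "(2 * real m + 1) * s \<le> real k * s"
        using 1 s(1)[OF k] by (intro mult_right_mono) auto
      also have "\<dots> \<le> u * (2 * real m + 1)" using ks[OF k] SR R0 um by simp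
      finally have "(2 * real m + 1) * s \<le> (2 * real m + 1) * u" by (simp add: mult.commute)
      then show ?thesis by (rule mult_left_le_imp_le) simp
    qed
    then show ?thesis using pointwise[OF k] low s(1)[OF k] by auto
  next
    case 2
    then have k: "0 < k" using m1 by simp
    have s_eq: "s = 1/2 - R / (2 * real m)"
      using ks[OF k] SR 2 m by (simp add: field_simps)
    show ?thesis
    proof (cases "u \<le> R")
      case True
      have "u = 1/2 - u / (2 * real m)" using um m by (simp add: field_simps)
      moreover have "u / (2 * real m) \<le> R / (2 * real m)"
        using True m by (intro divide_right_mono) auto
      ultimately have "s \<le> u" using s_eq by linarith
      then show ?thesis using pointwise[OF k] low s(1)[OF k] by auto
    next
      case False
      \<comment> \<open>merging is allowed because \<open>\<phi> x / x\<close> decreases on \<open>{0<..R}\<close>\<close>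
      have sub: "\<phi> R \<le> (\<Sum>i\<in>I - A. \<phi> (t i))"
      proof (cases "R = 0")
        case True
        then show ?thesis by (simp add: \<phi>_def sum_nonneg)
      next
        case Rne: False
        have "R * \<phi> R = (\<Sum>i\<in>I - A. t i * \<phi> R)" by (simp add: R_def sum_distrib_right)
        also have "\<dots> \<le> (\<Sum>i\<in>I - A. R * \<phi> (t i))"
        proof (rule sum_mono)
          fix i assume i: "i \<in> I - A"
          have "t i \<le> R" unfolding R_def using i small fin by (intro member_le_sum) auto
          then show "t i * \<phi> R \<le> R * \<phi> (t i)"
            unfolding \<phi>_def using False ub small[OF i] bpos by (intro odds_powr_ratio_mono) auto
        qed
        also have "\<dots> = R * (\<Sum>i\<in>I - A. \<phi> (t i))" by (simp add: sum_distrib_left)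
        finally show ?thesis using R0 Rne by (simp add: mult_le_cancel_left)
      qed
      have "2 * real m \<le> 2 * real m * \<phi> s + \<phi> R"
        unfolding s_eq \<phi>_def using False R0
        by (intro odds_powr_two_level[OF m b]) (auto simp: u_def)
      then show ?thesis using sub jensen[OF k] split 2 by (simp add: \<phi>_def)
    qed
  next
    case 3
    show ?thesis
    proof (cases "real k / 2 \<le> S")
      case True
      show ?thesis
      proof (cases "0 < k")
        case k: True
        have "1/2 \<le> s" using True k by (simp add: s_def field_simps)
        then show ?thesis using pointwise[OF k] high s(2)[OF k] by auto
      next
        case False
        then have "A = {}" using A by (simp add: k_def)
        then show ?thesis using rest SR split by (simp add: \<phi>_def S_def)
      qed
    next
      case False
      then have k: "0 < k" using A by (cases "A = {}") (auto simp: k_def S_def card_gt_0_iff)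
      \<comment> \<open>the possibly fractional number of values after replacing the small ones by copies of \<open>1/4\<close>\<close>
      define W where "W = real k + 4 * R"
      have W: "2 * real m + 1 \<le> W" using False SR 3 by (simp add: W_def)
      then have W0: "0 < W" by simp
      have restR: "4 * R * \<phi> (1/4) \<le> (\<Sum>i\<in>I - A. \<phi> (t i))"
        unfolding R_def sum_distrib_left sum_distrib_right
      proof (rule sum_mono)
        fix i assume i: "i \<in> I - A"
        have "t i * \<phi> (1/4) \<le> 1/4 * \<phi> (t i)"
          unfolding \<phi>_def using small[OF i] ub u bpos by (intro odds_powr_ratio_mono) auto
        then show "4 * t i * \<phi> (1/4) \<le> \<phi> (t i)" by simp
      qed
      define c where "c = 4 * R / W"
      have l: "0 \<le> c" "c \<le> 1" "1 - c = real k / W"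
        using R0 W0 by (auto simp: c_def W_def field_simps)
      have "(1 - c) *\<^sub>R s + c *\<^sub>R (1/4) = real m / W"
        using ks[OF k] SR W0 unfolding l(3) by (simp add: c_def flip: add_divide_distrib)
      then have "\<phi> (real m / W) \<le> (1 - c) * \<phi> s + c * \<phi> (1/4)"
        using convex_onD[OF convex_on_odds_powr[OF b(1)], of c s "1/4"] l s[OF k]
        by (simp add: \<phi>_def)
      also have "\<dots> = (real k * \<phi> s + 4 * R * \<phi> (1/4)) / W"
        unfolding l(3) by (simp add: c_def add_divide_distrib)
      finally have *: "W * \<phi> (real m / W) \<le> real k * \<phi> s + 4 * R * \<phi> (1/4)"
        using W0 by (simp add: field_simps)
      have "2 * (real m / W) \<le> \<phi> (real m / W)"
      proof (rule low)
        show "real m / W \<le> u" unfolding u_def using W m by (intro divide_left_mono) auto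
      qed (use W0 in auto)
      then have "2 * real m \<le> W * \<phi> (real m / W)" using W0 by (simp add: field_simps)
      then show ?thesis using * restR jensen[OF k] split by (simp add: \<phi>_def)
    qed
  qed
qed

section \<open>From matrices to the diagonal of a projection\<close>

lemma powr_sum_le_sum_powr:
  fixes y :: "'i \<Rightarrow> real"
  assumes "finite I" "\<And>i. i \<in> I \<Longrightarrow> 0 \<le> y i" "0 < b" "b \<le> 1"
  shows "(\<Sum>i\<in>I. y i) powr b \<le> (\<Sum>i\<in>I. y i powr b)"
proof (cases "(\<Sum>i\<in>I. y i) = 0")
  case True
  then show ?thesis by (simp add: sum_nonneg)
next
  case False
  define Y where "Y = (\<Sum>i\<in>I. y i)"
  have Y: "0 < Y" using False assms(2) sum_nonneg[of I y] by (simp add: Y_def)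
  have "Y powr b = (\<Sum>i\<in>I. y i / Y) * Y powr b"
    using Y by (simp add: Y_def flip: sum_divide_distrib)
  also have "\<dots> \<le> (\<Sum>i\<in>I. (y i / Y) powr b) * Y powr b"
  proof (intro mult_right_mono sum_mono)
    fix i assume i: "i \<in> I"
    have "y i \<le> Y" unfolding Y_def using assms i by (intro member_le_sum) auto
    then have "(y i / Y) powr 1 \<le> (y i / Y) powr b"
      using assms(2)[OF i] assms(3,4) Y by (intro powr_mono') auto
    then show "y i / Y \<le> (y i / Y) powr b" using assms(2)[OF i] Y by simp
  qed simp
  also have "\<dots> = (\<Sum>i\<in>I. y i powr b)"
    using assms(2) Y by (auto simp: sum_distrib_right powr_divide intro!: sum.cong)
  finally show ?thesis by (simp add: Y_def)
qed

lemma dim_nullspace: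
  fixes A :: "real^'n^'m"
  shows "dim {x. A *v x = 0} + rank A = CARD('n)"
proof -
  have "{x. A *v x = 0} = {y \<in> UNIV. \<forall>x\<in>rows A. orthogonal x y}"
    by (auto simp: rows_def row_def orthogonal_def vec_eq_iff matrix_vector_mult_def inner_vec_def)
  also have "\<dots> = {y \<in> UNIV. \<forall>x\<in>span (rows A). orthogonal x y}"
    by (auto intro: span_base) (metis orthogonal_commute orthogonal_to_span)
  finally show ?thesis
    using dim_subspace_orthogonal_to_vectors[of "span (rows A)" UNIV]
    by (simp add: row_rank_def)
qed

text \<open>The vectors \<open>u i\<close> are the orthogonal projections of the standard basis vectors onto the null space;
  the last equation computes the trace of the projection as its rank.\<close>

lemma nullspace_projection:
  fixes A :: "real^'n^'m"
  obtains u :: "'n \<Rightarrow> real^'n" where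
    "\<And>i. A *v u i = 0" "\<And>i. u i \<bullet> u i = u i $ i"
    "(\<Sum>i\<in>UNIV. u i $ i) = real (CARD('n) - rank A)"
proof -
  define N where "N = {x. A *v x = 0}"
  have sub: "subspace N"
    by (auto simp: N_def subspace_def matrix_vector_right_distrib matrix_vector_mult_scaleR)
  obtain B where B: "B \<subseteq> N" "pairwise orthogonal B" "\<And>x. x \<in> B \<Longrightarrow> norm x = 1"
    "independent B" "card B = dim N" "span B = N"
    using orthonormal_basis_subspace[OF sub] by metis
  have finB: "finite B" using B(4) by (rule independent_imp_finite)
  define u where "u i = (\<Sum>v\<in>B. (v $ i) *\<^sub>R v)" for i
  have ui: "u i $ j = (\<Sum>v\<in>B. v $ i * v $ j)" for i j by (simp add: u_def)
  have "u i \<in> N" for i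
    unfolding u_def using B(1) by (intro subspace_sum[OF sub] subspace_scale[OF sub]) auto
  moreover have "u i \<bullet> u i = u i $ i" for i
  proof -
    have "v \<bullet> u i = v $ i" if v: "v \<in> B" for v
    proof -
      have "v \<bullet> u i = (\<Sum>w\<in>B. w $ i * (v \<bullet> w))" by (simp add: u_def inner_sum_right)
      also have "\<dots> = (\<Sum>w\<in>B. if w = v then v $ i else 0)"
      proof (rule sum.cong)
        fix w assume "w \<in> B"
        then show "w $ i * (v \<bullet> w) = (if w = v then v $ i else 0)"
          using B(2,3) v by (auto simp: pairwise_def orthogonal_def norm_eq_1)
      qed simp
      finally show ?thesis using finB v by simp
    qed
    then have "u i \<bullet> u i = (\<Sum>v\<in>B. v $ i * v $ i)"
      by (subst u_def) (simp add: inner_sum_left)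
    then show ?thesis by (simp add: ui)
  qed
  moreover have "(\<Sum>i\<in>UNIV. u i $ i) = real (CARD('n) - rank A)"
  proof -
    have "(\<Sum>i\<in>UNIV. u i $ i) = (\<Sum>v\<in>B. \<Sum>i\<in>UNIV. v $ i * v $ i)"
      unfolding ui by (rule sum.swap)
    also have "\<dots> = (\<Sum>v\<in>B. 1)"
      using B(3) by (intro sum.cong) (auto simp: norm_eq_1 inner_vec_def)
    also have "\<dots> = real (dim N)" using B(5) by simp
    also have "dim N = CARD('n) - rank A" using dim_nullspace[of A] by (simp add: N_def)
    finally show ?thesis .
  qed
  ultimately show thesis using that by (auto simp: N_def)
qed

text \<open>Row \<open>i\<close> of \<open>A *v u = 0\<close> expresses \<open>u $ i\<close> through the off-diagonal entries, and Cauchy-Schwarz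
  bounds the odds of \<open>u $ i\<close> by the sum of their squares. Since \<open>b \<le> 1\<close>, the power can then be
  moved inside that sum.\<close>

lemma row_energy_ge:
  fixes A :: "real^'n^'n" and u :: "real^'n"
  assumes u: "A *v u = 0" "u \<bullet> u = u $ i" and Aii: "A $ i $ i = 1"
    and b: "0 < b" "b \<le> 1"
  shows "0 \<le> u $ i" "u $ i < 1" "odds_powr b (u $ i) \<le> (\<Sum>j\<in>-{i}. \<bar>A $ i $ j\<bar> powr (2 * b))"
proof -
  define t where "t = u $ i"
  define X where "X = (\<Sum>j\<in>-{i}. (A $ i $ j)^2)"
  have X0: "0 \<le> X" by (simp add: X_def sum_nonneg)
  show t0: "0 \<le> u $ i" using u(2) inner_ge_zero[of u] by simp
  have split: "sum f UNIV = f i + sum f (-{i})" for f :: "'n \<Rightarrow> real"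
    by (simp add: sum.remove[of UNIV i] Compl_eq_Diff_UNIV)
  have "(\<Sum>j\<in>UNIV. A $ i $ j * u $ j) = 0"
    using arg_cong[OF u(1), of "\<lambda>x. x $ i"] by (simp add: matrix_vector_mult_def)
  then have "(\<Sum>j\<in>-{i}. A $ i $ j * u $ j) = - t"
    using Aii split[of "\<lambda>j. A $ i $ j * u $ j"] by (simp add: t_def)
  moreover have "(\<Sum>j\<in>-{i}. (u $ j)^2) = t - t^2"
    using u(2) split[of "\<lambda>j. (u $ j)^2"] by (simp add: inner_vec_def t_def power2_eq_square)
  ultimately have cs: "t^2 \<le> X * (t - t^2)"
    using Cauchy_Schwarz_ineq_sum[of "\<lambda>j. A $ i $ j" "\<lambda>j. u $ j" "-{i}"] by (simp add: X_def)
  have "t * (1 - t) \<ge> 0"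
    using \<open>(\<Sum>j\<in>-{i}. (u $ j)^2) = t - t^2\<close> sum_nonneg[of "-{i}" "\<lambda>j. (u $ j)^2"]
    by (simp add: power2_eq_square algebra_simps)
  then have "t \<le> 1" using t0 by (auto simp: t_def zero_le_mult_iff)
  moreover have "t \<noteq> 1" using cs by auto
  ultimately show t1: "u $ i < 1" by (simp add: t_def)
  have "t / (1 - t) \<le> X"
  proof (cases "t = 0")
    case False
    then have tp: "0 < t" using t0 by (simp add: t_def)
    have "t * t \<le> t * (X * (1 - t))" using cs by (simp add: power2_eq_square algebra_simps)
    then have "t \<le> X * (1 - t)" using tp by (rule mult_left_le_imp_le)
    then show ?thesis using t1 by (simp add: t_def pos_divide_le_eq)
  qed (use X0 in simp)
  then have "odds_powr b t \<le> X powr b"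
    unfolding odds_powr_def using b t0 t1 by (intro powr_mono2) (auto simp: t_def)
  also have "\<dots> \<le> (\<Sum>j\<in>-{i}. ((A $ i $ j)^2) powr b)"
    unfolding X_def using b by (intro powr_sum_le_sum_powr) auto
  also have "\<dots> = (\<Sum>j\<in>-{i}. \<bar>A $ i $ j\<bar> powr (2 * b))"
  proof (rule sum.cong)
    fix j
    have "((A $ i $ j)^2) powr b = (\<bar>A $ i $ j\<bar> powr 2) powr b" by simp
    then show "((A $ i $ j)^2) powr b = \<bar>A $ i $ j\<bar> powr (2 * b)" by (simp only: powr_powr)
  qed simp
  finally show "odds_powr b (u $ i) \<le> (\<Sum>j\<in>-{i}. \<bar>A $ i $ j\<bar> powr (2 * b))" by (simp add: t_def)
qed

section \<open>The energy bound\<close>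

theorem theoremI1:
  fixes d m :: nat and p :: real and A :: "real^'n^'n"
  assumes "1 \<le> m" and "m < d"
    and "1 \<le> p"
    and "p \<le> 2 * ln ((2 * real m + 1) / (2 * real m)) / ln ((real m + 1) / real m)"
    and "CARD('n) = d + m"
    and "rank A = d"
    and "\<And>i. A $ i $ i = 1"
  shows "frame_energy p A \<ge> 2 * real m"
proof -
  define b where "b = p / 2"
  have m: "1 \<le> real m" using assms(1) by simp
  have b: "1/2 \<le> b" "b \<le> ln ((2 * real m + 1) / (2 * real m)) / ln ((real m + 1) / real m)"
    using assms(3,4) by (simp_all add: b_def mult.commute)
  have "(real m + 1) / (2 * real m + 1) \<le> 1" by (simp add: divide_le_eq_1)
  then have b01: "0 < b" "b \<le> 1" using b(1) exponent_le[OF m b(2)] by linarith+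
  obtain u :: "'n \<Rightarrow> real^'n" where u: "\<And>i. A *v u i = 0" "\<And>i. u i \<bullet> u i = u i $ i"
    "(\<Sum>i\<in>UNIV. u i $ i) = real (CARD('n) - rank A)"
    using nullspace_projection[of A] by blast
  note row = row_energy_ge[OF u(1) u(2) assms(7) b01]
  have "2 * real m \<le> (\<Sum>i\<in>UNIV. odds_powr b (u i $ i))"
    using row(1,2) u(3) assms(5,6) by (intro sum_odds_powr_ge[OF _ _ _ assms(1) b]) auto
  also have "\<dots> \<le> (\<Sum>i\<in>UNIV. \<Sum>j\<in>-{i}. \<bar>A $ i $ j\<bar> powr p)"
    using row(3) by (intro sum_mono) (simp add: b_def)
  also have "\<dots> = frame_energy p A"
  proof -
    have "{(i, j). i \<noteq> j} = (SIGMA i:UNIV. - {i :: 'n})" by auto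
    then show ?thesis by (simp add: frame_energy_def sum.Sigma)
  qed
  finally show ?thesis .
qed

end
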